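(* Let $f(t)=\sum_{k=0}^{d}a_kt^k$ be a real univariate polynomial with $a_k>0$ for $k=0,\dots,d$ that is strictly CLC for $t\ge0$. If $1\le d\le4$, then $f(t)$ is Hurwitz-stable.
   Context: A univariate polynomial $h$ is log-concave on $[0,\infty)$ if $h(t)>0$ and $\frac{d^2}{dt^2}\log h(t)\le0$ for all $t\ge0$, and strictly log-concave there if moreover $\frac{d^2}{dt^2}\log h(t)<0$ for all $t\ge0$. A univariate polynomial $f$ of degree $d$ is strictly CLC (strictly completely log-concave) for $t\ge0$ if $f^{(m)}$ is log-concave on $[0,\infty)$ for all $0\le m\le d$ and strictly log-concave on $[0,\infty)$ for all $0\le m\le d-1$. A univariate polynomial is Hurwitz-stable if all its complex roots have negative real part. *)

theory Defs
  imports "HOL-Analysis.Analysis" "HOL-Computational_Algebra.Polynomial"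
begin

text \<open>
  The derivative \<^const>\<open>deriv\<close> is two-sided also at the endpoint \<open>t = 0\<close>. There is no boundary
  effect: since \<open>h(t) > 0\<close> is required at each \<open>t \<ge> 0\<close>, the function \<open>ln \<circ> h\<close> is smooth in a
  neighbourhood of each such \<open>t\<close>.
\<close>

definition log_concave_nonneg :: "real poly \<Rightarrow> bool" where
  "log_concave_nonneg h \<longleftrightarrow>
     (\<forall>t\<ge>0. poly h t > 0 \<and> (deriv ^^ 2) (\<lambda>s. ln (poly h s)) t \<le> 0)"

definition strictly_log_concave_nonneg :: "real poly \<Rightarrow> bool" where
  "strictly_log_concave_nonneg h \<longleftrightarrow>
     log_concave_nonneg h \<and> (\<forall>t\<ge>0. (deriv ^^ 2) (\<lambda>s. ln (poly h s)) t < 0)"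

text \<open>
  The range \<open>0 \<le> m \<le> d - 1\<close> is written \<open>m < d\<close>, so that it is empty for \<open>d = 0\<close>.
\<close>

definition strictly_CLC_nonneg :: "real poly \<Rightarrow> bool" where
  "strictly_CLC_nonneg f \<longleftrightarrow>
     (\<forall>m\<le>degree f. log_concave_nonneg ((pderiv ^^ m) f)) \<and>
     (\<forall>m<degree f. strictly_log_concave_nonneg ((pderiv ^^ m) f))"

definition Hurwitz_stable :: "complex poly \<Rightarrow> bool" where
  "Hurwitz_stable p \<longleftrightarrow> (\<forall>z. poly p z = 0 \<longrightarrow> Re z < 0)"

end

theory Submission
  imports Defs
begin

text \<open>
  Log-concavity of all derivatives on \<open>[0, \<infinity>)\<close> is a condition that is invariant under the
  translations \<open>t \<mapsto> x + t\<close> with \<open>x \<ge> 0\<close>. A root \<open>x + iy\<close> with \<open>x \<ge> 0\<close> therefore becomes a purely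
  imaginary root \<open>iy\<close> of the translated polynomial, whose coefficients are \<open>c\<^sub>k / k!\<close> with
  \<open>c\<^sub>k = f\<^bsup>(k)\<^esup>(x)\<close>. The logarithmic second derivative has the sign of \<open>h h'' - h'\<^sup>2\<close>, so the
  hypothesis says that, for every \<open>x \<ge> 0\<close>, the numbers \<open>c\<^sub>0, \<dots>, c\<^sub>d\<close> are positive and that
  \<open>c\<^sub>m c\<^sub>m\<^sub>+\<^sub>2 < c\<^sub>m\<^sub>+\<^sub>1\<^sup>2\<close> for \<open>m < d\<close>. In degree at most four the real and imaginary parts of the
  equation at \<open>iy\<close> are so short that \<open>y\<close> can be eliminated; the resulting equation is the
  vanishing of a Hurwitz determinant (up to a factor), and these inequalities forbid it
  (\<open>no_imaginary_root_quartic\<close>).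
\<close>

lemma strictly_log_concave_nonneg_imp_less:
  fixes h :: "real poly"
  assumes "strictly_log_concave_nonneg h" and "t \<ge> 0"
  shows "poly h t * poly (pderiv (pderiv h)) t < (poly (pderiv h) t)\<^sup>2"
proof -
  have pos: "poly h t > 0"
    using assms by (auto simp: strictly_log_concave_nonneg_def log_concave_nonneg_def)
  have D1: "deriv (\<lambda>s. ln (poly h s)) s = poly (pderiv h) s / poly h s" if "poly h s > 0" for s
    by (rule DERIV_imp_deriv) (use that in \<open>auto intro!: derivative_eq_intros simp: field_simps\<close>)
  \<comment> \<open>The second derivative at \<open>t\<close> sees the first one on a neighbourhood, where \<open>h\<close> is still
    positive by continuity, also to the left of \<open>t = 0\<close>.\<close>
  have "((\<lambda>s. poly h s) \<longlongrightarrow> poly h t) (nhds t)"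
    using poly_isCont[of t h] by (simp add: isCont_def tendsto_nhds_iff)
  then have "\<forall>\<^sub>F s in nhds t. poly h s > 0"
    using pos by (rule order_tendstoD)
  then have ev: "\<forall>\<^sub>F s in nhds t. deriv (\<lambda>s. ln (poly h s)) s = poly (pderiv h) s / poly h s"
    by eventually_elim (rule D1)
  have "(deriv ^^ 2) (\<lambda>s. ln (poly h s)) t = deriv (\<lambda>s. poly (pderiv h) s / poly h s) t"
    using deriv_cong_ev[OF ev refl] by (simp add: numeral_2_eq_2)
  also have "\<dots> = (poly (pderiv (pderiv h)) t * poly h t - (poly (pderiv h) t)\<^sup>2) / (poly h t)\<^sup>2"
    by (rule DERIV_imp_deriv)
       (use pos in \<open>auto intro!: derivative_eq_intros simp: power2_eq_square\<close>)
  finally have "(poly (pderiv (pderiv h)) t * poly h t - (poly (pderiv h) t)\<^sup>2) / (poly h t)\<^sup>2 < 0"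
    using assms unfolding strictly_log_concave_nonneg_def by metis
  then show ?thesis
    using pos by (simp add: divide_less_0_iff mult.commute)
qed

lemma coeff_pcompose_translate:
  fixes p :: "'a::field_char_0 poly"
  shows "coeff (pcompose p [:x, 1:]) k = poly ((pderiv ^^ k) p) x / fact k"
proof -
  have "(pderiv ^^ k) (pcompose p [:x, 1:]) = pcompose ((pderiv ^^ k) p) [:x, 1:]"
    by (induction k) (auto simp: pderiv_pcompose pderiv_pCons)
  then have "poly ((pderiv ^^ k) (pcompose p [:x, 1:])) 0 = poly ((pderiv ^^ k) p) x"
    by (simp add: poly_pcompose)
  then show ?thesis
    by (simp add: poly_0_coeff_0 coeff_higher_pderiv nonzero_eq_divide_eq mult.commute flip: pochhammer_fact)
qed

lemma poly_map_of_real_pcompose_translate: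
  "poly (map_poly complex_of_real (pcompose p [:x, 1:])) w
    = poly (map_poly complex_of_real p) (of_real x + w)"
proof (induction p)
  case (pCons a p)
  have "map_poly complex_of_real (q + r) = map_poly of_real q + map_poly of_real r"
    "map_poly complex_of_real (smult b q) = smult (of_real b) (map_poly of_real q)" for q r b
    by (simp_all add: poly_eq_iff coeff_map_poly)
  then show ?case
    using pCons by (simp add: pcompose_pCons map_poly_pCons algebra_simps)
qed simp

lemma poly_map_of_real_taylor:
  assumes "degree p \<le> n"
  shows "poly (map_poly complex_of_real p) (of_real x + w)
    = (\<Sum>k\<le>n. of_real (poly ((pderiv ^^ k) p) x / fact k) * w ^ k)"
proof -
  let ?q = "map_poly complex_of_real (pcompose p [:x, 1:])"
  have "degree ?q \<le> n"
    using assms by (simp add: degree_map_poly degree_pcompose)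
  then have "poly ?q w = (\<Sum>k\<le>n. coeff ?q k * w ^ k)"
    unfolding poly_altdef by (intro sum.mono_neutral_left) (auto simp: coeff_eq_0)
  then show ?thesis
    by (simp add: poly_map_of_real_pcompose_translate coeff_map_poly coeff_pcompose_translate)
qed

text \<open>
  The vanishing of the imaginary part gives \<open>y\<^sup>2 = 6 c1 / c3\<close>; inserting it into the real part and
  clearing denominators leaves \<open>c0 c3\<^sup>2 + 3/2 c4 c1\<^sup>2 = 3 c1 c2 c3\<close>. After multiplication by
  \<open>c2\<close>, log-concavity bounds the left-hand side by \<open>5/2 c1\<^sup>2 c3\<^sup>2\<close>, whereas the right-hand side
  exceeds \<open>3 c1\<^sup>2 c3\<^sup>2\<close>.
\<close>

lemma no_imaginary_root_quartic:
  fixes y :: real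
  assumes pos: "c1 > 0" "c2 > 0" "c3 > 0"
    and lc: "c0 * c2 < c1\<^sup>2" "c1 * c3 < c2\<^sup>2" "c2 * c4 < c3\<^sup>2"
    and re: "c0 - c2 / 2 * y\<^sup>2 + c4 / 24 * y ^ 4 = 0"
    and im: "c1 = c3 / 6 * y\<^sup>2"
  shows False
proof -
  have y2: "c3 * y\<^sup>2 = 6 * c1"
    using im by simp
  have "c3\<^sup>2 * (c0 - c2 / 2 * y\<^sup>2 + c4 / 24 * y ^ 4)
      = c0 * c3\<^sup>2 - c2 * c3 / 2 * (c3 * y\<^sup>2) + c4 / 24 * (c3 * y\<^sup>2)\<^sup>2"
    by (simp add: algebra_simps power2_eq_square power4_eq_xxxx)
  then have eq: "c0 * c3\<^sup>2 + 3 / 2 * c4 * c1\<^sup>2 = 3 * c1 * c2 * c3"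
    unfolding re y2 by (simp add: algebra_simps power2_eq_square)
  have "c0 * c2 * c3\<^sup>2 < c1\<^sup>2 * c3\<^sup>2" "c2 * c4 * c1\<^sup>2 < c3\<^sup>2 * c1\<^sup>2"
    "c1 * c3 * (c1 * c3) < c2\<^sup>2 * (c1 * c3)"
    using pos lc by (auto intro!: mult_strict_right_mono)
  moreover have "c0 * c2 * c3\<^sup>2 + 3 / 2 * (c2 * c4 * c1\<^sup>2) = 3 * (c2\<^sup>2 * (c1 * c3))"
    using arg_cong[OF eq, of "\<lambda>u. c2 * u"] by (simp add: algebra_simps power2_eq_square)
  moreover have "c1 * c3 * (c1 * c3) = c1\<^sup>2 * c3\<^sup>2" "c3\<^sup>2 * c1\<^sup>2 = c1\<^sup>2 * c3\<^sup>2"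
    "c1\<^sup>2 * c3\<^sup>2 > 0"
    using pos by (simp_all add: power2_eq_square)
  ultimately show False
    by linarith
qed

lemma strictly_CLC_nonneg_imp_Hurwitz_stable:
  assumes clc: "strictly_CLC_nonneg f" and deg: "degree f \<le> 4"
  shows "Hurwitz_stable (map_poly complex_of_real f)"
  unfolding Hurwitz_stable_def
proof (intro allI impI, rule ccontr)
  fix z
  assume root: "poly (map_poly complex_of_real f) z = 0" and "\<not> Re z < 0"
  define x where "x = Re z"
  define y where "y = Im z"
  define c where "c k = poly ((pderiv ^^ k) f) x" for k
  have x: "x \<ge> 0"
    using \<open>\<not> Re z < 0\<close> by (simp add: x_def)
  have pos: "c k > 0" if "k \<le> degree f" for k
    using clc x that by (auto simp: strictly_CLC_nonneg_def log_concave_nonneg_def c_def)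
  have lc: "c k * c (Suc (Suc k)) < (c (Suc k))\<^sup>2" if "k < degree f" for k
    using strictly_log_concave_nonneg_imp_less[of "(pderiv ^^ k) f" x] clc x that
    by (simp add: strictly_CLC_nonneg_def c_def)
  have "z = of_real x + \<i> * of_real y"
    by (simp add: x_def y_def complex_eq)
  then have "(\<Sum>k\<le>4. of_real (c k / fact k) * (\<i> * of_real y) ^ k) = 0"
    using root poly_map_of_real_taylor[OF deg, of x "\<i> * of_real y"] by (simp add: c_def)
  moreover have "(\<Sum>k\<le>4. of_real (c k / fact k) * (\<i> * of_real y) ^ k)
      = Complex (c 0 - c 2 / 2 * y\<^sup>2 + c 4 / 24 * y ^ 4) (y * (c 1 - c 3 / 6 * y\<^sup>2))"
    by (simp add: complex_eq_iff eval_nat_numeral algebra_simps fact_numeral)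
  ultimately have re: "c 0 - c 2 / 2 * y\<^sup>2 + c 4 / 24 * y ^ 4 = 0"
    and im: "y * (c 1 - c 3 / 6 * y\<^sup>2) = 0"
    by (simp_all add: complex_eq_iff)
  have "y \<noteq> 0"
    using re pos[of 0] by auto
  then have im': "c 1 = c 3 / 6 * y\<^sup>2"
    using im by simp
  \<comment> \<open>In degree below three the imaginary part of \<open>f (x + iy)\<close> is \<open>c 1 * y\<close>; as \<open>y \<noteq> 0\<close>, it vanishes
    only for constant \<open>f\<close>, and then the real part is \<open>c 0 > 0\<close>. From degree three on, all
    three log-concavity inequalities up to index \<open>4\<close> are available, with \<open>c 4 = 0\<close> for a cubic.\<close>
  have "degree f \<ge> 3"
  proof (rule ccontr)
    assume "\<not> degree f \<ge> 3"
    have zero: "c k = 0" if "k > degree f" for k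
    proof -
      have "(pderiv ^^ k) f = 0"
        using that by (intro poly_eqI) (simp add: coeff_higher_pderiv coeff_eq_0)
      then show ?thesis
        by (simp add: c_def)
    qed
    have "c 1 = 0"
      using im' zero[of 3] \<open>\<not> degree f \<ge> 3\<close> by simp
    then have "degree f = 0"
      using pos[of 1] by linarith
    then show False
      using re zero[of 2] zero[of 4] pos[of 0] by simp
  qed
  then show False
    using no_imaginary_root_quartic[OF _ _ _ _ _ _ re im'] pos[of 1] pos[of 2] pos[of 3]
      lc[of 0] lc[of 1] lc[of 2]
    by (simp add: eval_nat_numeral)
qed

theorem corollary4p15:
  fixes f :: "real poly" and a :: "nat \<Rightarrow> real" and d :: nat
  assumes "f = (\<Sum>k\<le>d. monom (a k) k)"
    and "\<And>k. k \<le> d \<Longrightarrow> a k > 0"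
    and "strictly_CLC_nonneg f"
    and "1 \<le> d" and "d \<le> 4"
  shows "Hurwitz_stable (map_poly complex_of_real f)"
proof -
  have "degree f \<le> d"
    unfolding assms(1) by (intro degree_sum_le) (auto intro: degree_monom_le order_trans)
  then show ?thesis
    using assms(3,5) by (intro strictly_CLC_nonneg_imp_Hurwitz_stable) auto
qed

end
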